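(* Let $p$ be an odd prime and define $c_p(x)=x^{-1}\sum_{\ell=-\infty}^{\infty}p^{-\ell}\|p^\ell x\|^2$ for $x>0$. Let $x>0$ and put $k_j=[p^jx]$. Then as $j\to\infty$, $v_p(g_{k_j,U})\sim k_j\,c_p(x)$ and $v_p(g_{k_j,O})\sim v_p(g_{k_j,Sp})\sim\tfrac12 k_j\,c_p(x)$.
   Context: $\|t\|$ is the distance from $t$ to the nearest integer; $[t]$ is the floor of $t$; $v_p(n)$ is the exponent of $p$ in the rational number $n$. For $\lambda\in\mathbb{C}$ let $B_U(\lambda)=\lambda^2$, $B_O(\lambda)=\tfrac12\lambda(\lambda-1)$, $B_{Sp}(\lambda)=\tfrac12\lambda(\lambda+1)$. Define $G_U(\lambda)=\lim_{N\to\infty}N^{-\lambda^2}\prod_{j=1}^{N}\frac{\Gamma(j)\Gamma(j+2\lambda)}{\Gamma(j+\lambda)^2}$, $G_O(\lambda)=\tfrac12\lim_{N\to\infty}N^{-\lambda(\lambda-1)/2}\,2^{2N\lambda}\prod_{j=1}^{N}\frac{\Gamma(N+j-1)\Gamma(j-\frac12+\lambda)}{\Gamma(N+j-1+\lambda)\Gamma(j-\frac12)}$, $G_{Sp}(\lambda)=\lim_{N\to\infty}N^{-\lambda(\lambda+1)/2}\,2^{2N\lambda}\prod_{j=1}^{N}\frac{\Gamma(N+j+1)\Gamma(j+\frac12+\lambda)}{\Gamma(N+j+1+\lambda)\Gamma(j+\frac12)}$, and $g_{\lambda,X}=\Gamma(1+B_X(\lambda))G_X(\lambda)$ for $X\in\{U,O,Sp\}$.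 *)

theory Defs
  imports "HOL-Analysis.Analysis" "HOL-Library.Landau_Symbols"
    "HOL-Computational_Algebra.Factorial_Ring"
begin

definition nint_dist :: "real \<Rightarrow> real" where
  "nint_dist t = min (frac t) (1 - frac t)"

definition vp_rat :: "nat \<Rightarrow> rat \<Rightarrow> int" where
  "vp_rat p q = (if q = 0 then 0 else
     (case quotient_of q of (a, b) \<Rightarrow>
        int (multiplicity (int p) a) - int (multiplicity (int p) b)))"

definition vp :: "nat \<Rightarrow> complex \<Rightarrow> int" where
  "vp p z = (if z \<in> \<rat> then vp_rat p (THE q. of_rat q = z) else 0)"

definition B_U :: "complex \<Rightarrow> complex" where "B_U l = l^2"
definition B_O :: "complex \<Rightarrow> complex" where "B_O l = l * (l - 1) / 2"
definition B_Sp :: "complex \<Rightarrow> complex" where "B_Sp l = l * (l + 1) / 2"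

definition G_U :: "complex \<Rightarrow> complex" where
  "G_U l = lim (\<lambda>N. of_nat N powr (- (l^2)) *
     (\<Prod>j=1..N. Gamma (of_nat j) * Gamma (of_nat j + 2*l) / (Gamma (of_nat j + l))^2))"

definition G_O :: "complex \<Rightarrow> complex" where
  "G_O l = 1/2 * lim (\<lambda>N. of_nat N powr (- (l * (l - 1) / 2)) * 2 powr (2 * of_nat N * l) *
     (\<Prod>j=1..N. Gamma (of_nat N + of_nat j - 1) * Gamma (of_nat j - 1/2 + l)
        / (Gamma (of_nat N + of_nat j - 1 + l) * Gamma (of_nat j - 1/2))))"

definition G_Sp :: "complex \<Rightarrow> complex" where
  "G_Sp l = lim (\<lambda>N. of_nat N powr (- (l * (l + 1) / 2)) * 2 powr (2 * of_nat N * l) *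
     (\<Prod>j=1..N. Gamma (of_nat N + of_nat j + 1) * Gamma (of_nat j + 1/2 + l)
        / (Gamma (of_nat N + of_nat j + 1 + l) * Gamma (of_nat j + 1/2))))"

definition g_U :: "complex \<Rightarrow> complex" where "g_U l = Gamma (1 + B_U l) * G_U l"
definition g_O :: "complex \<Rightarrow> complex" where "g_O l = Gamma (1 + B_O l) * G_O l"
definition g_Sp :: "complex \<Rightarrow> complex" where "g_Sp l = Gamma (1 + B_Sp l) * G_Sp l"

definition c_p :: "nat \<Rightarrow> real \<Rightarrow> real" where
  "c_p p x = (\<Sum>\<^sub>\<infinity>l::int. real p powi (-l) * (nint_dist (real p powi l * x))^2) / x"

end

theory Submission
  imports Defs "HOL-Real_Asymp.Real_Asymp"
begin

text \<open>
  For integral \<open>k\<close> the limits are products of factorials: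
  \<open>g\<^sub>U(k) = (k\<^sup>2)! \<Prod>\<^bsub>i<k\<^esub> i!/(k+i)!\<close> and
  \<open>g\<^sub>O(k) = (k(k-1)/2)! \<Prod>\<^bsub>i<k\<^esub> i!/(2i)!\<close> up to a power of 2, while \<open>g\<^sub>S\<^sub>p(k)\<close> is
  \<open>g\<^sub>O(k+1)\<close> up to a power of 2. Legendre's formula writes the valuation as a sum over prime powers
  \<open>q = p\<^sup>l\<close>, and the identity \<open>8q \<Sum>\<^bsub>i<n\<^esub> \<lfloor>i/q\<rfloor> = (2n-q)\<^sup>2 - (2(n mod q)-q)\<^sup>2\<close> shows that the term
  belonging to \<open>q\<close> differs from \<open>q \<parallel>k/q\<parallel>\<^sup>2\<close> (respectively half of it) by a bounded amount.
  Only \<open>O(j)\<close> prime powers matter for \<open>k \<approx> p\<^sup>j x\<close>, and replacing \<open>k\<close> by \<open>p\<^sup>j x\<close> costs at most 1 for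
  each of them; dividing by \<open>p\<^sup>j\<close> leaves partial sums of the series that defines \<open>c\<^sub>p\<close>.
\<close>

subsection \<open>Legendre's formula and valuations of quotients\<close>

text \<open>Induction on \<open>n\<close>: in the step \<open>n div p ^ l\<close> rises by one
  exactly when \<open>p ^ l\<close> divides \<open>Suc n\<close>. Any large enough cut-off
  \<open>L\<close> is allowed, so factorials of different sizes can share one range of
  summation.\<close>

lemma multiplicity_fact:
  fixes p :: nat
  assumes "prime p" "n < p ^ Suc L"
  shows "multiplicity p (fact n) = (\<Sum>l=1..L. n div p ^ l)"
  using assms(2)
proof (induction n)
  case 0
  then show ?case by simp
next
  case (Suc n)
  have p: "p > 1" using assms(1) prime_gt_1_nat by blast
  have "multiplicity p (Suc n) \<le> L"
  proof -
    have "p ^ multiplicity p (Suc n) \<le> Suc n" by (simp add: dvd_imp_le multiplicity_dvd)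
    hence "p ^ multiplicity p (Suc n) < p ^ Suc L" using Suc.prems by linarith
    thus ?thesis using p by (meson less_Suc_eq_le power_less_imp_less_exp)
  qed
  hence "{l \<in> {1..L}. p ^ l dvd Suc n} = {1..multiplicity p (Suc n)}"
    using p by (auto simp: power_dvd_iff_le_multiplicity)
  hence m: "multiplicity p (Suc n) = (\<Sum>l=1..L. if p ^ l dvd Suc n then 1 else 0)"
    by (simp flip: sum.inter_filter)
  have "multiplicity p (fact (Suc n)) = multiplicity p (Suc n) + multiplicity p (fact n)"
    unfolding fact_Suc of_nat_id using assms(1) by (intro prime_elem_multiplicity_mult_distrib) auto
  also have "\<dots> = (\<Sum>l=1..L. Suc n div p ^ l)"
    using Suc by (subst m) (auto simp: div_Suc dvd_eq_mod_eq_0 simp flip: sum.distrib intro!: sum.cong)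
  finally show ?case .
qed

text \<open>\<open>vp\<close> reads its value off the fraction returned by
  \<open>quotient_of\<close>. Cross-multiplying that fraction with \<open>a / b\<close> carries the
  multiplicities over to any representation by positive naturals.\<close>

lemma vp_divide_of_nat:
  assumes "prime p" "a > 0" "b > 0"
  shows "vp p (of_nat a / of_nat b) = int (multiplicity p a) - int (multiplicity p b)"
proof -
  define q :: rat where "q = of_nat a / of_nat b"
  have q: "of_rat q = (of_nat a / of_nat b :: complex)" by (simp add: q_def of_rat_divide)
  have "vp p (of_nat a / of_nat b) = vp_rat p q"
    unfolding vp_def q[symmetric] by simp
  also obtain c d where cd: "quotient_of q = (c, d)" by fastforce
  have "q \<noteq> 0" using assms by (simp add: q_def)
  have d: "d > 0" using quotient_of_denom_pos[OF cd] .
  have "q = of_int c / of_int d" using quotient_of_div[OF cd] .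
  hence "of_nat a * of_int d = (of_int c * of_nat b :: rat)"
    using assms d by (simp add: q_def field_simps)
  hence eq: "int a * d = c * int b" by (metis of_int_eq_iff of_int_mult of_int_of_nat_eq)
  hence "c \<noteq> 0" using assms d by auto
  have P: "prime_elem (int p)" using assms(1) by simp
  have mi: "multiplicity (int p) (int n) = multiplicity p n" for n
  proof -
    have "int p ^ l dvd int n \<longleftrightarrow> p ^ l dvd n" for l
      by (metis of_nat_dvd_iff of_nat_power)
    thus ?thesis unfolding multiplicity_def by simp
  qed
  have "multiplicity (int p) (int a * d) = multiplicity (int p) (c * int b)" using eq by simp
  hence "multiplicity p a + multiplicity (int p) d = multiplicity (int p) c + multiplicity p b"
    using assms d \<open>c \<noteq> 0\<close> by (simp add: prime_elem_multiplicity_mult_distrib[OF P] mi)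
  hence "vp_rat p q = int (multiplicity p a) - int (multiplicity p b)"
    using \<open>q \<noteq> 0\<close> cd by (simp add: vp_rat_def)
  finally show ?thesis .
qed

section \<open>Floor sums and distances to multiples of \<open>q\<close>\<close>

text \<open>Both sides grow by \<open>8 * (n - n mod q)\<close> when \<open>n\<close> increases by
  one.\<close>

lemma sum_div_below:
  fixes q :: nat
  assumes "q > 0"
  shows "8 * int q * (\<Sum>i<n. int (i div q)) = (2 * int n - int q)\<^sup>2 - (2 * int (n mod q) - int q)\<^sup>2"
proof (induction n)
  case 0
  then show ?case by simp
next
  case (Suc n)
  have n: "int q * int (n div q) = int n - int (n mod q)"
    by (metis add_diff_cancel_right' mult_div_mod_eq of_nat_add of_nat_mult)
  \<comment> \<open>The residue may wrap from \<open>q - 1\<close> to \<open>0\<close>. This turns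
    \<open>q\<close> into \<open>- q\<close> inside the square, so the square is unaffected.\<close>
  have "(2 * int (Suc n mod q) - int q)\<^sup>2 = (2 * int (n mod q) + 2 - int q)\<^sup>2"
  proof (cases "Suc (n mod q) = q")
    case True
    hence "2 * int (n mod q) + 2 - int q = int q" by linarith
    thus ?thesis using True by (simp add: mod_Suc)
  qed (simp add: mod_Suc algebra_simps)
  then show ?case using Suc n by (simp add: power2_eq_square algebra_simps)
qed

text \<open>Integer form of floor(2t) - floor(t) = floor(t + 1/2), where the odd denominator turns
  the half step into \<open>h\<close>. Both sides are the quotient of \<open>i\<close>, plus one if
  its remainder exceeds \<open>h\<close>.\<close>

lemma double_div_minus_div:
  "int (2 * i div (2 * h + 1)) - int (i div (2 * h + 1)) = int ((i + h) div (2 * h + 1))"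
proof -
  define q where "q = 2 * h + 1"
  define a r where "a = i div q" and "r = i mod q"
  have i: "i = a * q + r" "r < q" by (unfold a_def r_def div_mult_mod_eq, simp_all add: q_def)
  have "2 * i div q = 2 * a + (if r > h then 1 else 0)"
    by (intro div_nat_eqI) (use i in \<open>auto simp: q_def algebra_simps\<close>)
  moreover have "(i + h) div q = a + (if r > h then 1 else 0)"
    by (intro div_nat_eqI) (use i in \<open>auto simp: q_def algebra_simps\<close>)
  ultimately show ?thesis by (simp add: a_def q_def)
qed

lemma nint_dist_of_nat_divide:
  fixes q :: nat
  assumes "q > 0"
  shows "nint_dist (real k / real q) = min (real (k mod q)) (real q - real (k mod q)) / real q"
proof -
  have "frac (real k / real q) = real (k mod q) / real q"
  proof -
    have "real k / real q = real (k mod q) / real q + of_int (int (k div q))"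
      using assms by (simp add: field_simps) (metis mod_mult_div_eq of_nat_add of_nat_mult add.commute mult.commute)
    moreover have "real (k mod q) / real q < 1" using assms by simp
    ultimately show ?thesis using frac_unique_iff[of "real k / real q" "real (k mod q) / real q"] by auto
  qed
  moreover have "1 - real (k mod q) / real q = (real q - real (k mod q)) / real q"
    using assms by (simp add: field_simps)
  ultimately show ?thesis
    unfolding nint_dist_def using assms by (simp add: min_divide_distrib_right)
qed

lemma real_div_bounds:
  fixes q :: nat
  assumes "q > 0"
  shows "\<bar>real (n div q) - real n / real q\<bar> \<le> 1"
  by (smt (verit) floor_divide_of_nat_eq of_int_of_nat_eq real_of_int_floor_ge_diff_one
      of_int_floor_le)

subsection \<open>Values at natural numbers\<close>

lemma tendsto_linear_ratio:
  "(\<lambda>N. of_nat (a * N + b) / of_nat N :: complex) \<longlonglongrightarrow> of_nat a"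
proof -
  have "(\<lambda>N. of_nat a + of_nat b * (1 / of_nat N) :: complex) \<longlonglongrightarrow> of_nat a + of_nat b * 0"
    by (intro tendsto_intros lim_1_over_n)
  moreover have "eventually (\<lambda>N. of_nat a + of_nat b * (1 / of_nat N) =
      (of_nat (a * N + b) / of_nat N :: complex)) sequentially"
    using eventually_gt_at_top[of 0] by eventually_elim (simp add: field_simps)
  ultimately show ?thesis by (simp add: tendsto_cong)
qed

lemma tendsto_prod_linear_ratio:
  "(\<lambda>N. (\<Prod>m=1..M. of_nat (a * N + b m)) / of_nat N ^ M :: complex) \<longlonglongrightarrow> of_nat a ^ M"
proof -
  have "(\<lambda>N. \<Prod>m=1..M. of_nat (a * N + b m) / of_nat N :: complex) \<longlonglongrightarrow> (\<Prod>m=1..M. of_nat a)"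
    by (intro tendsto_prod tendsto_linear_ratio)
  thus ?thesis by (simp add: prod_dividef)
qed

lemma fact_add_eq_prod: "(fact (M + N) :: complex) = fact M * (\<Prod>j=1..N. of_nat (M + j))"
  by (induction N) (simp_all add: algebra_simps)

text \<open>A duplication formula: it turns the half-integer products in \<open>G_O\<close> and
  \<open>G_Sp\<close> into factorials. The power \<open>4 ^ N\<close> is supplied by the factor
  \<open>2 powr (2 * of_nat N * l)\<close> of those definitions.\<close>

lemma fact_double_eq_prod:
  "(fact (2 * (N + i)) * fact i :: complex) =
     4 ^ N * (\<Prod>j=1..N. of_nat (i + j) - 1/2) * fact (N + i) * fact (2 * i)"
proof (induction N)
  case 0
  then show ?case by simp
next
  case (Suc N)
  have "(fact (2 * (Suc N + i)) :: complex) = fact (2 * (N + i)) *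
      (4 * (of_nat (i + Suc N) - 1/2) * of_nat (Suc N + i))"
    by (simp add: algebra_simps)
  hence "(fact (2 * (Suc N + i)) * fact i :: complex) = (fact (2 * (N + i)) * fact i) *
      (4 * (of_nat (i + Suc N) - 1/2) * of_nat (Suc N + i))"
    by (simp only: mult_ac)
  also have "\<dots> = 4 ^ Suc N * (\<Prod>j=1..Suc N. of_nat (i + j) - 1/2) * fact (Suc N + i) * fact (2 * i)"
    unfolding Suc by (simp add: mult_ac)
  finally show ?case .
qed

text \<open>A shift by a natural number \<open>k\<close> costs a product of \<open>k\<close>
  factors. The products over \<open>j\<close> up to \<open>N\<close> in the limits can thus be
  regrouped into \<open>k\<close> products of length \<open>N\<close>, with \<open>k\<close> fixed
  as \<open>N\<close> grows.\<close>

lemma Gamma_quotient_eq_prod: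
  fixes a b :: complex
  assumes "Re a > 0" "Re b > 0"
  shows "Gamma a * Gamma (b + of_nat k) / (Gamma (a + of_nat k) * Gamma b) =
           (\<Prod>i<k. (b + of_nat i) / (a + of_nat i))"
proof -
  have *: "Gamma (z + of_nat k) = Gamma z * (\<Prod>i<k. z + of_nat i) \<and> Gamma z \<noteq> 0"
    if "Re z > 0" for z :: complex
  proof -
    have z: "z \<notin> \<int>\<^sub>\<le>\<^sub>0" using that by (auto elim!: nonpos_Ints_cases)
    thus ?thesis using pochhammer_Gamma[OF z, of k]
      by (simp add: Gamma_eq_zero_iff pochhammer_prod atLeast0LessThan field_simps)
  qed
  show ?thesis using *[OF assms(1)] *[OF assms(2)] by (simp add: prod_dividef)
qed

lemma powr_minus_of_nat:
  assumes "n > 0"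
  shows "(of_nat n :: complex) powr (- of_nat k) = 1 / of_nat n ^ k"
  using assms by (simp add: powr_minus powr_nat' field_simps)

lemma two_powr_double_of_nat: "(2 :: complex) powr (2 * of_nat N * of_nat k) = (4 ^ N) ^ k"
proof -
  have "(2 :: complex) powr of_nat (2 * N * k) = 2 ^ (2 * N * k)" by (rule powr_nat') simp
  thus ?thesis by (simp add: power_mult)
qed

text \<open>Collects the powers \<open>N ^ i\<close> contributed by the single factors into the
  exponent that occurs in \<open>G_O\<close>.\<close>

lemma of_nat_sum_lessThan: "(of_nat (\<Sum>i<k. i) :: complex) = of_nat k * (of_nat k - 1) / 2"
  by (induction k) (simp_all add: field_simps)

lemma of_nat_sum_Suc_lessThan: "(of_nat (\<Sum>i<k. Suc i) :: complex) = of_nat k * (of_nat k + 1) / 2"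
  by (induction k) (simp_all add: field_simps)

section \<open>Closed forms of the three limits\<close>

text \<open>After the two products are swapped, the \<open>i\<close>-th inner product is a quotient
  of factorials that grows like \<open>N ^ k\<close>. The \<open>k\<close> such powers cancel the
  prefactor with exponent \<open>- (k^2)\<close>.\<close>

lemma G_U_of_nat: "G_U (of_nat k) = (\<Prod>i<k. fact i / fact (k + i))"
proof -
  \<comment> \<open>The \<open>i\<close>-th inner product divided by its growth
    \<open>N ^ k\<close>; \<open>1 * N\<close> fits the pattern of
    \<open>tendsto_prod_linear_ratio\<close>.\<close>
  define F where "F i N = (fact i / fact (k + i)) *
    ((\<Prod>m=1..k. of_nat (1 * N + (i + m))) / of_nat N ^ k :: complex)" for i N
  define T where "T N = of_nat N powr (- ((of_nat k)^2)) *
     (\<Prod>j=1..N. Gamma (of_nat j) * Gamma (of_nat j + 2 * of_nat k) /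
        (Gamma (of_nat j + of_nat k))^2 :: complex)" for N
  have "(\<lambda>N. \<Prod>i<k. F i N) \<longlonglongrightarrow> (\<Prod>i<k. (fact i / fact (k + i)) * of_nat 1 ^ k)"
    unfolding F_def by (intro tendsto_prod tendsto_mult tendsto_const tendsto_prod_linear_ratio)
  moreover have "eventually (\<lambda>N. T N = (\<Prod>i<k. F i N)) sequentially"
    using eventually_gt_at_top[of 0]
  proof eventually_elim
    case (elim N)
    have "Gamma (of_nat j) * Gamma (of_nat j + 2 * of_nat k) / (Gamma (of_nat j + of_nat k))^2 =
      (\<Prod>i<k. of_nat (k + i + j) / of_nat (i + j) :: complex)" if "j \<in> {1..N}" for j
    proof -
      have "of_nat j + of_nat k + of_nat k = (of_nat j + 2 * of_nat k :: complex)" by simp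
      thus ?thesis using Gamma_quotient_eq_prod[of "of_nat j" "of_nat j + of_nat k" k] that
        by (simp add: power2_eq_square add_ac)
    qed
    hence "(\<Prod>j=1..N. Gamma (of_nat j) * Gamma (of_nat j + 2 * of_nat k) / (Gamma (of_nat j + of_nat k))^2) =
      (\<Prod>i<k. \<Prod>j=1..N. of_nat (k + i + j) / of_nat (i + j) :: complex)"
      by (subst prod.swap) (rule prod.cong, simp_all)
    also have "(\<lambda>i. \<Prod>j=1..N. of_nat (k + i + j) / of_nat (i + j) :: complex) =
        (\<lambda>i. F i N * of_nat N ^ k)"
    proof
      fix i
      have a: "(fact (k + i + N) :: complex) = fact (k + i) * (\<Prod>j=1..N. of_nat (k + i + j))"
        by (rule fact_add_eq_prod)
      have b: "(fact (i + N) :: complex) = fact i * (\<Prod>j=1..N. of_nat (i + j))"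
        by (rule fact_add_eq_prod)
      have c: "(fact (i + N + k) :: complex) = fact (i + N) * (\<Prod>j=1..k. of_nat (i + N + j))"
        by (rule fact_add_eq_prod)
      have "(\<Prod>j=1..N. of_nat (k + i + j) / of_nat (i + j) :: complex) =
         (fact (k + i + N) / fact (k + i)) / (fact (i + N) / fact i)"
        unfolding a b by (simp add: prod_dividef del: of_nat_add)
      \<comment> \<open>The reordering exposes \<open>fact (i + N)\<close> inside the larger
        factorial and leaves \<open>k\<close> factors linear in \<open>N\<close>.\<close>
      also have "k + i + N = i + N + k" by simp
      also have "(fact (i + N + k) / fact (k + i)) / (fact (i + N) / fact i) = F i N * of_nat N ^ k"
        using elim unfolding c F_def by (simp add: field_simps)
      finally show "(\<Prod>j=1..N. of_nat (k + i + j) / of_nat (i + j) :: complex) = F i N * of_nat N ^ k" .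
    qed
    finally show ?case
      using powr_minus_of_nat[OF elim, of "k\<^sup>2"] elim
      by (simp add: T_def prod.distrib power_mult power2_eq_square)
  qed
  ultimately have "T \<longlonglongrightarrow> (\<Prod>i<k. (fact i / fact (k + i)) * of_nat 1 ^ k)"
    by (simp add: tendsto_cong)
  thus ?thesis unfolding G_U_def T_def by (simp add: limI)
qed

text \<open>By duplication, \<open>4 ^ N\<close> times the \<open>i\<close>-th inner product is
  \<open>fact i / fact (2 * i)\<close> times \<open>i + 1\<close> factors of size about
  \<open>2 * N\<close>, over one factor of size about \<open>N\<close>. It grows like
  \<open>N ^ i\<close>, and these exponents add up to \<open>k * (k - 1) / 2\<close>.\<close>

lemma G_O_of_nat: "G_O (of_nat k) = 1/2 * (\<Prod>i<k. 2 ^ Suc i * fact i / fact (2 * i))"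
proof -
  define F where "F i N = (fact i / fact (2 * i)) *
    ((\<Prod>m=1..Suc i. of_nat (2 * N + (i + m - 1))) / of_nat N ^ Suc i) *
    (1 / (of_nat (1 * N + i) / of_nat N) :: complex)" for i N
  define T where "T N = of_nat N powr (- (of_nat k * (of_nat k - 1) / 2)) *
     2 powr (2 * of_nat N * of_nat k) *
     (\<Prod>j=1..N. Gamma (of_nat N + of_nat j - 1) * Gamma (of_nat j - 1/2 + of_nat k) /
        (Gamma (of_nat N + of_nat j - 1 + of_nat k) * Gamma (of_nat j - 1/2)) :: complex)" for N
  have "(\<lambda>N. \<Prod>i<k. F i N) \<longlonglongrightarrow> (\<Prod>i<k. (fact i / fact (2 * i)) * of_nat 2 ^ Suc i * (1 / of_nat 1))"
    unfolding F_def
    by (intro tendsto_prod tendsto_mult tendsto_divide[OF tendsto_const tendsto_linear_ratio]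
          tendsto_const tendsto_prod_linear_ratio) simp
  moreover have "eventually (\<lambda>N. T N = (\<Prod>i<k. F i N)) sequentially"
    using eventually_gt_at_top[of 0]
  proof eventually_elim
    case (elim N)
    have "Gamma (of_nat N + of_nat j - 1) * Gamma (of_nat j - 1/2 + of_nat k) /
        (Gamma (of_nat N + of_nat j - 1 + of_nat k) * Gamma (of_nat j - 1/2)) =
      (\<Prod>i<k. (of_nat (i + j) - 1/2) / of_nat (N + i - 1 + j) :: complex)" if "j \<in> {1..N}" for j
    proof -
      \<comment> \<open>\<open>N > 0\<close> prevents truncation in the natural number
        \<open>N + i - 1\<close>.\<close>
      have "(of_nat (N + i - 1 + j) :: complex) = of_nat N + of_nat j - 1 + of_nat i" for i
        using elim by (simp add: of_nat_diff)
      thus ?thesis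
        using Gamma_quotient_eq_prod[of "of_nat N + of_nat j - 1" "of_nat j - 1/2" k] that elim
        by (simp add: algebra_simps)
    qed
    hence "(\<Prod>j=1..N. Gamma (of_nat N + of_nat j - 1) * Gamma (of_nat j - 1/2 + of_nat k) /
        (Gamma (of_nat N + of_nat j - 1 + of_nat k) * Gamma (of_nat j - 1/2))) =
      (\<Prod>i<k. \<Prod>j=1..N. (of_nat (i + j) - 1/2) / of_nat (N + i - 1 + j) :: complex)"
      by (subst prod.swap) (rule prod.cong, simp_all)
    hence "T N = of_nat N powr (- of_nat (\<Sum>i<k. i)) *
        (\<Prod>i<k. 4 ^ N * (\<Prod>j=1..N. (of_nat (i + j) - 1/2) / of_nat (N + i - 1 + j)))"
      unfolding T_def of_nat_sum_lessThan two_powr_double_of_nat by (simp add: prod.distrib)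
    also have "(\<lambda>i. 4 ^ N * (\<Prod>j=1..N. (of_nat (i + j) - 1/2) / of_nat (N + i - 1 + j)) :: complex) =
        (\<lambda>i. F i N * of_nat N ^ i)"
    proof
      fix i
      have a: "(fact (N + i - 1 + N) :: complex) = fact (N + i - 1) * (\<Prod>j=1..N. of_nat (N + i - 1 + j))"
        by (rule fact_add_eq_prod)
      have b: "(fact (N + i - 1 + N + Suc i) :: complex) =
          fact (N + i - 1 + N) * (\<Prod>j=1..Suc i. of_nat (N + i - 1 + N + j))"
        by (rule fact_add_eq_prod)
      have "N + i - 1 + N + j = 2 * N + (i + j - 1)" if "j \<ge> 1" for j using that elim by simp
      hence b': "(\<Prod>j=1..Suc i. of_nat (N + i - 1 + N + j)) =
          (\<Prod>j=1..Suc i. of_nat (2 * N + (i + j - 1)) :: complex)"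
        by (intro prod.cong) auto
      have c: "(fact (N + i) :: complex) = of_nat (N + i) * fact (N + i - 1)"
        using elim by (cases "N + i") auto
      have d: "N + i - 1 + N + Suc i = 2 * (N + i)" using elim by simp
      have nz: "(of_nat (N + i) :: complex) \<noteq> 0" "(of_nat N :: complex) \<noteq> 0"
        using elim by (simp_all only: of_nat_eq_0_iff)
      have "4 ^ N * (\<Prod>j=1..N. of_nat (i + j) - 1/2) =
          (fact (2 * (N + i)) * fact i / (fact (N + i) * fact (2 * i)) :: complex)"
        unfolding fact_double_eq_prod by simp
      hence "4 ^ N * (\<Prod>j=1..N. (of_nat (i + j) - 1/2) / of_nat (N + i - 1 + j)) =
         (fact (2 * (N + i)) * fact i / (fact (N + i) * fact (2 * i))) /
         (fact (N + i - 1 + N) / fact (N + i - 1) :: complex)"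
        unfolding a by (simp add: prod_dividef del: of_nat_add)
      also have "\<dots> = F i N * of_nat N ^ i"
        unfolding d[symmetric] b b' c F_def using nz by (simp add: divide_simps del: of_nat_add) 
      finally show "4 ^ N * (\<Prod>j=1..N. (of_nat (i + j) - 1/2) / of_nat (N + i - 1 + j)) =
        (F i N * of_nat N ^ i :: complex)" .
    qed
    finally show ?case
      using elim by (simp add: prod.distrib powr_minus_of_nat power_sum del: of_nat_sum)
  qed
  ultimately have "T \<longlonglongrightarrow> (\<Prod>i<k. (fact i / fact (2 * i)) * of_nat 2 ^ Suc i * (1 / of_nat 1))"
    by (simp add: tendsto_cong)
  thus ?thesis unfolding G_O_def T_def by (simp add: limI mult_ac)
qed

text \<open>Parallel to \<open>G_O\<close>, with indices from \<open>1\<close> to \<open>k\<close>.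
  The shifted Gamma arguments leave exactly \<open>i\<close> linear factors and no denominator, so
  the exponents add up to \<open>k * (k + 1) / 2\<close>.\<close>

lemma G_Sp_of_nat: "G_Sp (of_nat k) = (\<Prod>i<k. 2 ^ Suc i * fact (Suc i) / fact (2 * Suc i))"
proof -
  define F where "F i N = (fact i / fact (2 * i)) *
    ((\<Prod>m=1..i. of_nat (2 * N + (i + m))) / of_nat N ^ i :: complex)" for i N
  define T where "T N = of_nat N powr (- (of_nat k * (of_nat k + 1) / 2)) *
     2 powr (2 * of_nat N * of_nat k) *
     (\<Prod>j=1..N. Gamma (of_nat N + of_nat j + 1) * Gamma (of_nat j + 1/2 + of_nat k) /
        (Gamma (of_nat N + of_nat j + 1 + of_nat k) * Gamma (of_nat j + 1/2)) :: complex)" for N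
  have "(\<lambda>N. \<Prod>i<k. F (Suc i) N) \<longlonglongrightarrow> (\<Prod>i<k. (fact (Suc i) / fact (2 * Suc i)) * of_nat 2 ^ Suc i)"
    unfolding F_def
    by (intro tendsto_prod tendsto_mult tendsto_const tendsto_prod_linear_ratio)
  moreover have "eventually (\<lambda>N. T N = (\<Prod>i<k. F (Suc i) N)) sequentially"
    using eventually_gt_at_top[of 0]
  proof eventually_elim
    case (elim N)
    have "Gamma (of_nat N + of_nat j + 1) * Gamma (of_nat j + 1/2 + of_nat k) /
        (Gamma (of_nat N + of_nat j + 1 + of_nat k) * Gamma (of_nat j + 1/2)) =
      (\<Prod>i<k. (of_nat (Suc i + j) - 1/2) / of_nat (N + Suc i + j) :: complex)" if "j \<in> {1..N}" for j
      using Gamma_quotient_eq_prod[of "of_nat N + of_nat j + 1" "of_nat j + 1/2" k] that elim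
      by (simp add: algebra_simps)
    hence "(\<Prod>j=1..N. Gamma (of_nat N + of_nat j + 1) * Gamma (of_nat j + 1/2 + of_nat k) /
        (Gamma (of_nat N + of_nat j + 1 + of_nat k) * Gamma (of_nat j + 1/2))) =
      (\<Prod>i<k. \<Prod>j=1..N. (of_nat (Suc i + j) - 1/2) / of_nat (N + Suc i + j) :: complex)"
      by (subst prod.swap) (rule prod.cong, simp_all)
    hence "T N = of_nat N powr (- of_nat (\<Sum>i<k. Suc i)) *
        (\<Prod>i<k. 4 ^ N * (\<Prod>j=1..N. (of_nat (Suc i + j) - 1/2) / of_nat (N + Suc i + j)))"
      unfolding T_def of_nat_sum_Suc_lessThan two_powr_double_of_nat by (simp add: prod.distrib)
    also have "(\<lambda>i. 4 ^ N * (\<Prod>j=1..N. (of_nat (Suc i + j) - 1/2) / of_nat (N + Suc i + j)) :: complex) =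
        (\<lambda>i. F (Suc i) N * of_nat N ^ Suc i)"
    proof
      fix i0
      define i where "i = Suc i0"
      have a: "(fact (N + i + N) :: complex) = fact (N + i) * (\<Prod>j=1..N. of_nat (N + i + j))"
        by (rule fact_add_eq_prod)
      have b: "(fact (N + i + N + i) :: complex) =
          fact (N + i + N) * (\<Prod>j=1..i. of_nat (N + i + N + j))"
        by (rule fact_add_eq_prod)
      have b': "(\<Prod>j=1..i. of_nat (N + i + N + j)) = (\<Prod>j=1..i. of_nat (2 * N + (i + j)) :: complex)"
        by (intro prod.cong) auto
      have d: "N + i + N + i = 2 * (N + i)" by simp
      have nz: "(of_nat N :: complex) \<noteq> 0" using elim by simp
      have "4 ^ N * (\<Prod>j=1..N. of_nat (i + j) - 1/2) =
          (fact (2 * (N + i)) * fact i / (fact (N + i) * fact (2 * i)) :: complex)"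
        unfolding fact_double_eq_prod by simp
      hence "4 ^ N * (\<Prod>j=1..N. (of_nat (i + j) - 1/2) / of_nat (N + i + j)) =
         (fact (2 * (N + i)) * fact i / (fact (N + i) * fact (2 * i))) /
         (fact (N + i + N) / fact (N + i) :: complex)"
        unfolding a by (simp add: prod_dividef del: of_nat_add)
      also have "\<dots> = F i N * of_nat N ^ i"
        unfolding d[symmetric] b b' F_def using nz by (simp add: divide_simps del: of_nat_add) 
      finally show "4 ^ N * (\<Prod>j=1..N. (of_nat (Suc i0 + j) - 1/2) / of_nat (N + Suc i0 + j)) =
        (F (Suc i0) N * of_nat N ^ Suc i0 :: complex)" unfolding i_def .
    qed
    finally show ?case
      using elim by (simp add: prod.distrib powr_minus_of_nat power_sum del: of_nat_sum power_Suc)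
  qed
  ultimately have "T \<longlonglongrightarrow> (\<Prod>i<k. (fact (Suc i) / fact (2 * Suc i)) * of_nat 2 ^ Suc i)"
    by (simp add: tendsto_cong)
  thus ?thesis unfolding G_Sp_def T_def by (simp add: limI mult_ac)
qed

subsection \<open>The distance to the nearest integer and the constant\<close>

lemma nint_dist_nonneg: "0 \<le> nint_dist t" and nint_dist_le_half: "nint_dist t \<le> 1/2"
  using frac_lt_1[of t] by (simp_all add: nint_dist_def min_def)

text \<open>Together with \<open>nint_dist_attained\<close> this makes \<open>nint_dist\<close> a
  minimum of distances to integers; the Lipschitz bound then follows from the triangle
  inequality.\<close>

lemma nint_dist_le_abs_diff_int: "nint_dist t \<le> \<bar>t - of_int n\<bar>"
proof (cases "n \<le> \<lfloor>t\<rfloor>")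
  case True
  hence "of_int n \<le> (of_int \<lfloor>t\<rfloor> :: real)" by simp
  moreover have "of_int \<lfloor>t\<rfloor> \<le> t" by simp
  ultimately show ?thesis unfolding nint_dist_def frac_def by linarith
next
  case False
  hence "\<lfloor>t\<rfloor> + 1 \<le> n" by simp
  hence "of_int \<lfloor>t\<rfloor> + 1 \<le> (of_int n :: real)" by (metis of_int_1 of_int_add of_int_le_iff)
  thus ?thesis unfolding nint_dist_def frac_def by linarith
qed

lemma nint_dist_attained: obtains n where "nint_dist t = \<bar>t - of_int n\<bar>"
proof (cases "frac t \<le> 1 - frac t")
  case True
  show ?thesis
    by (rule that[of "\<lfloor>t\<rfloor>"]) (use True in \<open>simp add: nint_dist_def frac_def\<close>)
next
  case False
  show ?thesis
    by (rule that[of "\<lfloor>t\<rfloor> + 1"])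
       (use False frac_lt_1[of t] in \<open>simp add: nint_dist_def frac_def\<close>)
qed

lemma nint_dist_lipschitz: "\<bar>nint_dist a - nint_dist b\<bar> \<le> \<bar>a - b\<bar>"
proof -
  have "nint_dist a \<le> nint_dist b + \<bar>a - b\<bar>" for a b
  proof -
    obtain n where "nint_dist b = \<bar>b - of_int n\<bar>" by (rule nint_dist_attained)
    thus ?thesis using nint_dist_le_abs_diff_int[of a n] by linarith
  qed
  from this[of a b] this[of b a] show ?thesis by linarith
qed

text \<open>Factor the difference of squares: two values of \<open>nint_dist\<close> add up to at
  most 1.\<close>

lemma nint_dist_sq_lipschitz: "\<bar>(nint_dist a)\<^sup>2 - (nint_dist b)\<^sup>2\<bar> \<le> \<bar>a - b\<bar>"
proof -
  have "\<bar>(nint_dist a)\<^sup>2 - (nint_dist b)\<^sup>2\<bar> = \<bar>nint_dist a - nint_dist b\<bar> * (nint_dist a + nint_dist b)"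
    using nint_dist_nonneg[of a] nint_dist_nonneg[of b]
    by (simp add: abs_mult square_diff_square_factored power2_eq_square)
  also have "\<dots> \<le> \<bar>a - b\<bar> * 1"
    using nint_dist_nonneg[of a] nint_dist_nonneg[of b] nint_dist_le_half[of a] nint_dist_le_half[of b]
    by (intro mult_mono nint_dist_lipschitz) auto
  finally show ?thesis by simp
qed

lemma nint_dist_eq_self: "0 \<le> t \<Longrightarrow> t \<le> 1/2 \<Longrightarrow> nint_dist t = t"
  by (simp add: nint_dist_def frac_eq_id)

text \<open>The division by \<open>x\<close> in \<open>c_p\<close> is left out; it cancels against
  the factor \<open>x\<close> of \<open>p ^ j * x\<close>.\<close>

definition c_p_term :: "nat \<Rightarrow> real \<Rightarrow> int \<Rightarrow> real" where
  "c_p_term p x l = real p powi (-l) * (nint_dist (real p powi l * x))\<^sup>2"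

lemma c_p_term_nonneg: "0 \<le> c_p_term p x l"
  by (simp add: c_p_term_def)

text \<open>Both ends have geometric majorants. For \<open>l >= 0\<close> the distance is bounded;
  for \<open>l = - n\<close> it is at most \<open>\<bar>x\<bar> / p ^ n\<close>, whose square
  outweighs the factor \<open>p ^ n\<close>.\<close>

lemma c_p_term_summable:
  assumes "p > 1"
  shows "c_p_term p x summable_on UNIV"
proof -
  have geom: "(\<lambda>n::nat. C * (1 / real p) ^ n) summable_on UNIV" for C :: real
  proof -
    have "summable (\<lambda>n. (1 / real p) ^ n)" using assms by (simp add: summable_geometric)
    thus ?thesis using assms
      by (intro summable_on_cmult_right norm_summable_imp_summable_on) simp
  qed
  have "(\<lambda>n. c_p_term p x (int n)) summable_on UNIV"
  proof (rule summable_on_comparison_test[OF geom[of 1]])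
    fix n
    have "(nint_dist (real p ^ n * x))\<^sup>2 \<le> 1"
      using nint_dist_nonneg[of "real p ^ n * x"] nint_dist_le_half[of "real p ^ n * x"]
      by (intro power_le_one) auto
    thus "c_p_term p x (int n) \<le> 1 * (1 / real p) ^ n"
      using assms by (simp add: c_p_term_def power_int_minus field_simps)
  qed (simp add: c_p_term_nonneg)
  hence pos: "c_p_term p x summable_on {0..}"
    by (subst (asm) summable_on_reindex_bij_betw[of int UNIV "{0..}"])
       (intro bij_betwI[of _ _ _ nat], auto)
  have "(\<lambda>n. c_p_term p x (- int n)) summable_on UNIV"
  proof (rule summable_on_comparison_test[OF geom[of "x\<^sup>2"]])
    fix n
    have "(nint_dist (x / real p ^ n))\<^sup>2 \<le> (x / real p ^ n)\<^sup>2"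
      using nint_dist_le_abs_diff_int[of "x / real p ^ n" 0] nint_dist_nonneg[of "x / real p ^ n"]
      by (simp add: abs_le_square_iff[symmetric])
    hence "real p ^ n * (nint_dist (x / real p ^ n))\<^sup>2 \<le> real p ^ n * (x / real p ^ n)\<^sup>2"
      by (intro mult_left_mono) auto
    also have "\<dots> = x\<^sup>2 * (1 / real p) ^ n"
      using assms by (simp add: field_simps power2_eq_square)
    finally show "c_p_term p x (- int n) \<le> x\<^sup>2 * (1 / real p) ^ n"
      by (simp add: c_p_term_def power_int_minus field_simps)
  qed (simp add: c_p_term_nonneg)
  hence "c_p_term p x summable_on {..0}"
    by (subst (asm) summable_on_reindex_bij_betw[of "\<lambda>n. - int n" UNIV "{..0}"])
       (intro bij_betwI[of _ _ _ "\<lambda>m. nat (- m)"], auto)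
  with pos have "c_p_term p x summable_on ({0..} \<union> {..0})" by (rule summable_on_union)
  moreover have "{0..} \<union> {..0} = (UNIV :: int set)" by auto
  ultimately show ?thesis by simp
qed

text \<open>One positive term suffices: once \<open>p ^ n > 2 * x\<close>, the number
  \<open>x / p ^ n\<close> is its own distance to the nearest integer. Positivity later permits
  division by the limit.\<close>

lemma infsum_c_p_term_pos:
  assumes "p > 1" "x > 0"
  shows "infsum (c_p_term p x) UNIV > 0"
proof -
  obtain n where n: "2 * x < real p ^ n" using assms real_arch_pow[of "real p" "2 * x"] by auto
  have "nint_dist (x / real p ^ n) = x / real p ^ n"
    using n assms by (intro nint_dist_eq_self) (auto simp: field_simps)
  moreover have "x / real p ^ n > 0" using assms by simp
  ultimately have "c_p_term p x (- int n) > 0"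
    using assms by (simp add: c_p_term_def power_int_minus divide_inverse mult.commute)
  also have "c_p_term p x (- int n) = sum (c_p_term p x) {- int n}" by simp
  also have "\<dots> \<le> infsum (c_p_term p x) UNIV"
    using c_p_term_summable[OF assms(1)]
    by (intro finite_sum_le_infsum) (auto simp: c_p_term_nonneg)
  finally show ?thesis .
qed

text \<open>Connects the unordered sum in \<open>c_p\<close> with sums over intervals, which
  eventually contain any given finite set.\<close>

lemma filterlim_int_interval_finite_subsets:
  "filterlim (\<lambda>j. {- int j - int C..<int j}) (finite_subsets_at_top UNIV) sequentially"
  unfolding filterlim_finite_subsets_at_top
proof (intro allI impI)
  fix X :: "int set" assume X: "finite X \<and> X \<subseteq> UNIV"
  define b where "b = Max (insert 0 (abs ` X))"
  have b: "\<bar>m\<bar> \<le> b" if "m \<in> X" for m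
    unfolding b_def using X that by (intro Max_ge) auto
  show "eventually (\<lambda>j. finite {- int j - int C..<int j} \<and> X \<subseteq> {- int j - int C..<int j} \<and>
      {- int j - int C..<int j} \<subseteq> UNIV) sequentially"
    using eventually_gt_at_top[of "nat b"]
  proof eventually_elim
    case (elim j)
    hence "b < int j" by linarith
    thus ?case using b by fastforce
  qed
qed

text \<open>The substitution \<open>m = j - l\<close> turns the finite range of prime powers into a
  window of the two-sided series.\<close>

lemma sum_scaled_nint_dist_eq:
  assumes "p > 1"
  shows "(\<Sum>l=1..2*j+C. real p ^ l * (nint_dist (real p ^ j * x / real p ^ l))\<^sup>2) =
           real p ^ j * sum (c_p_term p x) {- int j - int C..<int j}"
proof -
  have "sum (c_p_term p x) {- int j - int C..<int j} =
      (\<Sum>l=1..2*j+C. c_p_term p x (int j - int l))"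
    by (rule sum.reindex_bij_witness[of _ "\<lambda>l. int j - int l" "\<lambda>m. nat (int j - m)"]) auto
  also have "real p ^ j * \<dots> = (\<Sum>l=1..2*j+C. real p ^ l * (nint_dist (real p ^ j * x / real p ^ l))\<^sup>2)"
    unfolding sum_distrib_left
    using assms by (intro sum.cong) (auto simp: c_p_term_def power_int_diff)
  finally show ?thesis by simp
qed

section \<open>From termwise estimates to asymptotics\<close>

text \<open>Serves all three families: \<open>K j\<close> will be the floor of
  \<open>p ^ j * x\<close> or its successor, \<open>c\<close> is 1 or 1/2, and \<open>D\<close> is
  the error allowed per prime power. The threshold on \<open>p ^ Suc L\<close> dominates every
  factorial argument that occurs.\<close>

lemma valuation_asymp_equiv:
  fixes p :: nat and x c D :: real and K :: "nat \<Rightarrow> nat" and V :: "nat \<Rightarrow> real"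
  assumes p: "p > 1" and x: "x > 0" and c: "c > 0"
    and K: "\<And>j. \<bar>real (K j) - real p ^ j * x\<bar> \<le> 1"
    and V: "eventually (\<lambda>j. \<forall>L. (K j)\<^sup>2 + 2 * K j < p ^ Suc L \<longrightarrow>
       \<bar>V j - c * (\<Sum>l=1..L. real p ^ l * (nint_dist (real (K j) / real p ^ l))\<^sup>2)\<bar> \<le> D * real L) sequentially"
  shows "V \<sim>[sequentially] (\<lambda>j. c * (real p ^ j * x) * c_p p x)"
proof -
  define I where "I = infsum (c_p_term p x) UNIV"
  have I: "I > 0" unfolding I_def by (rule infsum_c_p_term_pos[OF p x])
  have cp: "x * c_p p x = I" using x by (simp add: c_p_def I_def c_p_term_def[abs_def])
  \<comment> \<open>Since \<open>K j <= p ^ j * (x + 1)\<close>, the threshold is at most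
    \<open>p ^ (2 * j)\<close> times this constant, so \<open>L = 2 * j + C\<close> is large
    enough.\<close>
  obtain C where C: "(x + 1)\<^sup>2 + 2 * (x + 1) < real p ^ C"
    using p real_arch_pow[of "real p" "(x + 1)\<^sup>2 + 2 * (x + 1)"] by auto
  define S where "S j = sum (c_p_term p x) {- int j - int C..<int j}" for j
  have S: "S \<longlonglongrightarrow> I"
    using has_sum_infsum[OF c_p_term_summable[OF p, of x]] filterlim_int_interval_finite_subsets[of C]
    unfolding has_sum_def I_def S_def by (rule filterlim_compose)
  \<comment> \<open>Each prime power costs \<open>D\<close> from the hypothesis on \<open>V\<close>
    and \<open>c\<close> for replacing \<open>K j\<close> by \<open>p ^ j * x\<close>. The total is
    linear in \<open>j\<close> and vanishes after division by \<open>p ^ j\<close>.\<close>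
  have "eventually (\<lambda>j. \<bar>V j / real p ^ j - c * S j\<bar> \<le> (D + c) * real (2 * j + C) / real p ^ j) sequentially"
    using V
  proof eventually_elim
    case (elim j)
    define P where "P = real p ^ j"
    have P: "P \<ge> 1" using p by (simp add: P_def)
    define L where "L = 2 * j + C"
    have KP: "real (K j) \<le> P * (x + 1)" using K[of j] P by (simp add: P_def algebra_simps)
    have "real ((K j)\<^sup>2 + 2 * K j) \<le> (P * (x + 1))\<^sup>2 + 2 * (P * (x + 1))"
      using KP by (auto intro!: add_mono power_mono)
    also have "\<dots> \<le> P\<^sup>2 * ((x + 1)\<^sup>2 + 2 * (x + 1))"
      using P x self_le_power[of P 2] mult_right_mono[of P "P\<^sup>2" "2 * (x + 1)"]
      by (simp add: algebra_simps power2_eq_square)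
    also have "\<dots> < P\<^sup>2 * real p ^ C" using C P by (intro mult_strict_left_mono) auto
    also have "\<dots> = real (p ^ L)" by (simp add: P_def L_def power_add power_mult[symmetric] mult.commute)
    also have "\<dots> \<le> real (p ^ Suc L)" using p by simp
    finally have "(K j)\<^sup>2 + 2 * K j < p ^ Suc L" by linarith
    with elim have 1: "\<bar>V j - c * (\<Sum>l=1..L. real p ^ l * (nint_dist (real (K j) / real p ^ l))\<^sup>2)\<bar> \<le> D * real L"
      by blast
    \<comment> \<open>The weight \<open>p ^ l\<close> cancels against the change of at most
      \<open>1 / p ^ l\<close> in the argument.\<close>
    have "\<bar>(\<Sum>l=1..L. real p ^ l * (nint_dist (real (K j) / real p ^ l))\<^sup>2) -
          (\<Sum>l=1..L. real p ^ l * (nint_dist (P * x / real p ^ l))\<^sup>2)\<bar> \<le> (\<Sum>l=1..L. 1)"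
      unfolding sum_subtractf[symmetric]
    proof (rule order_trans[OF sum_abs], rule sum_mono)
      fix l
      have "\<bar>(nint_dist (real (K j) / real p ^ l))\<^sup>2 - (nint_dist (P * x / real p ^ l))\<^sup>2\<bar> \<le>
          \<bar>real (K j) / real p ^ l - P * x / real p ^ l\<bar>" by (rule nint_dist_sq_lipschitz)
      also have "\<dots> = \<bar>real (K j) - P * x\<bar> / real p ^ l"
        by (simp flip: diff_divide_distrib)
      also have "\<dots> \<le> 1 / real p ^ l" using K[of j] unfolding P_def by (intro divide_right_mono) auto
      finally have "real p ^ l * \<bar>(nint_dist (real (K j) / real p ^ l))\<^sup>2 -
          (nint_dist (P * x / real p ^ l))\<^sup>2\<bar> \<le> 1"
        using p by (simp add: pos_le_divide_eq mult.commute)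
      thus "\<bar>real p ^ l * (nint_dist (real (K j) / real p ^ l))\<^sup>2 -
          real p ^ l * (nint_dist (P * x / real p ^ l))\<^sup>2\<bar> \<le> 1"
        by (simp add: abs_mult flip: right_diff_distrib)
    qed
    hence "\<bar>(\<Sum>l=1..L. real p ^ l * (nint_dist (real (K j) / real p ^ l))\<^sup>2) - P * S j\<bar> \<le> real L"
      using sum_scaled_nint_dist_eq[OF p, of j x C] by (simp add: P_def L_def S_def)
    hence "c * \<bar>(\<Sum>l=1..L. real p ^ l * (nint_dist (real (K j) / real p ^ l))\<^sup>2) - P * S j\<bar> \<le> c * real L"
      using c by simp
    hence "\<bar>c * (\<Sum>l=1..L. real p ^ l * (nint_dist (real (K j) / real p ^ l))\<^sup>2) - c * (P * S j)\<bar> \<le> c * real L"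
      using c by (simp add: abs_mult flip: right_diff_distrib)
    with 1 have "\<bar>V j - c * (P * S j)\<bar> \<le> (D + c) * real L" unfolding distrib_right by linarith
    hence "\<bar>V j - c * (P * S j)\<bar> / P \<le> (D + c) * real L / P"
      using P by (intro divide_right_mono) auto
    moreover have "V j / P - c * S j = (V j - c * (P * S j)) / P" using P by (simp add: field_simps)
    ultimately show ?case using P by (simp add: L_def P_def)
  qed
  moreover have "(\<lambda>j. (D + c) * real (2 * j + C) / real p ^ j) \<longlonglongrightarrow> 0"
  proof -
    have "real p > 1" using p by simp
    hence "(\<lambda>j. real (2 * j + C) / real p ^ j) \<longlonglongrightarrow> 0" by real_asymp
    from tendsto_mult[OF tendsto_const[of "D + c"] this] show ?thesis by simp
  qed
  ultimately have "(\<lambda>j. V j / real p ^ j - c * S j) \<longlonglongrightarrow> 0"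
    unfolding real_norm_def[symmetric] by (rule Lim_null_comparison)
  from tendsto_add[OF this tendsto_mult[OF tendsto_const[of c] S]]
  have "(\<lambda>j. V j / real p ^ j) \<longlonglongrightarrow> c * I" by simp
  from tendsto_divide[OF this tendsto_const[of "c * I"]]
  have "(\<lambda>j. V j / real p ^ j / (c * I)) \<longlonglongrightarrow> 1" using c I by simp
  moreover have "V j / real p ^ j / (c * I) = V j / (c * (real p ^ j * x) * c_p p x)" for j
  proof -
    have "c * (real p ^ j * x) * c_p p x = real p ^ j * (c * I)"
      unfolding cp[symmetric] by (simp only: mult_ac)
    thus ?thesis by (simp only: divide_divide_eq_left)
  qed
  ultimately show ?thesis by (intro asymp_equivI') (simp only:)
qed

subsection \<open>Valuations at natural numbers\<close>

lemma sum_lessThan_add: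
  fixes f :: "nat \<Rightarrow> 'a :: comm_monoid_add"
  shows "(\<Sum>i<m+n. f i) = (\<Sum>i<m. f i) + (\<Sum>i<n. f (m + i))"
  by (induction n) (simp_all add: add.assoc)

text \<open>Let \<open>S n\<close> be the sum of \<open>i div q\<close> over \<open>i < n\<close>,
  and \<open>m\<close> the distance from \<open>k\<close> to the nearest multiple of
  \<open>q\<close>. The sums combine to \<open>2 * S k - S (2 * k)\<close>, which is exactly
  \<open>(m^2 - k^2) / q\<close>; the only error is the rounding in the first term.\<close>

lemma unitary_term_bound:
  fixes q k :: nat
  assumes "q > 0"
  shows "\<bar>real (k\<^sup>2 div q) + (\<Sum>i<k. real (i div q)) - (\<Sum>i<k. real ((k + i) div q))
           - real q * (nint_dist (real k / real q))\<^sup>2\<bar> \<le> 1"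
proof -
  define r where "r = k mod q"
  define m where "m = min (real r) (real q - real r)"
  have r: "r < q" using assms by (simp add: r_def)
  have S: "(\<Sum>i<n. real (i div q)) =
      ((2 * real n - real q)\<^sup>2 - (2 * real (n mod q) - real q)\<^sup>2) / (8 * real q)" for n
  proof -
    have "real_of_int (8 * int q * (\<Sum>i<n. int (i div q))) =
        real_of_int ((2 * int n - int q)\<^sup>2 - (2 * int (n mod q) - int q)\<^sup>2)"
      by (simp only: sum_div_below[OF assms])
    thus ?thesis using assms by (simp add: field_simps)
  qed
  have split: "(\<Sum>i<k. real ((k + i) div q)) = (\<Sum>i<k+k. real (i div q)) - (\<Sum>i<k. real (i div q))"
    by (simp add: sum_lessThan_add)
  have "(k + k) mod q = (r + r) mod q" by (simp add: r_def mod_add_eq)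
  also have "\<dots> = (if r + r < q then r + r else r + r - q)" using r by (simp add: mod_if)
  finally have r2: "real ((k + k) mod q) = (if r + r < q then 2 * real r else 2 * real r - real q)"
    by auto
  \<comment> \<open>The squares become unknowns, so the elimination of \<open>Q\<close> is
    linear.\<close>
  have lin: "2 * (Z - Y) - (W - X) = 8 * (M - T)"
    if "X - 2 * Y = 8 * M - Q" "2 * Z - W = Q - 8 * T" for X Y Z W M T Q :: real
    using that by (simp add: algebra_simps)
  \<comment> \<open>Both cases are the same identity in \<open>m\<close>: passing from
    \<open>r\<close> to \<open>q - r\<close> only changes signs inside the squares.\<close>
  have "(2 * real ((k + k) mod q) - real q)\<^sup>2 - 2 * (2 * real r - real q)\<^sup>2 = 8 * m\<^sup>2 - (real q)\<^sup>2"
  proof (cases "r + r < q")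
    case True
    hence m: "m = real r" by (simp add: m_def)
    show ?thesis using True unfolding m by (simp add: r2 power2_eq_square algebra_simps)
  next
    case False
    hence m: "m = real q - real r" by (simp add: m_def)
    show ?thesis using False unfolding m by (simp add: r2 power2_eq_square algebra_simps)
  qed
  moreover have "2 * (2 * real k - real q)\<^sup>2 - (2 * real (k + k) - real q)\<^sup>2 = (real q)\<^sup>2 - 8 * real (k\<^sup>2)"
    by (simp add: power2_eq_square algebra_simps)
  ultimately have "2 * ((2 * real k - real q)\<^sup>2 - (2 * real r - real q)\<^sup>2) -
      ((2 * real (k + k) - real q)\<^sup>2 - (2 * real ((k + k) mod q) - real q)\<^sup>2) = 8 * (m\<^sup>2 - real (k\<^sup>2))"
    by (rule lin)
  hence "2 * (\<Sum>i<k. real (i div q)) - (\<Sum>i<k+k. real (i div q)) = 8 * (m\<^sup>2 - real (k\<^sup>2)) / (8 * real q)"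
    unfolding S r_def[symmetric] times_divide_eq_right diff_divide_distrib[symmetric] by (simp only:)
  also have "\<dots> = m\<^sup>2 / real q - real (k\<^sup>2) / real q"
    by (simp add: diff_divide_distrib)
  finally have "2 * (\<Sum>i<k. real (i div q)) - (\<Sum>i<k+k. real (i div q)) = m\<^sup>2 / real q - real (k\<^sup>2) / real q" .
  moreover have "real q * (nint_dist (real k / real q))\<^sup>2 = m\<^sup>2 / real q"
    unfolding nint_dist_of_nat_divide[OF assms] using assms
    by (simp add: m_def r_def power2_eq_square)
  ultimately show ?thesis
    using real_div_bounds[OF assms, of "k\<^sup>2"] unfolding split by linarith
qed

text \<open>Oddness of \<open>q\<close> merges the two sums into one floor sum up to
  \<open>k + h\<close>, where \<open>2 * (k + h) - q = 2 * k - 1\<close>. As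
  \<open>k * (k - 1) / 2\<close> is \<open>((2 * k - 1)^2 - 1) / 8\<close>, the leading squares
  cancel. What is left is \<open>m^2 / (2 * q)\<close> up to 1/4, plus at most 1 for
  rounding.\<close>

lemma orthogonal_term_bound:
  fixes q k :: nat
  assumes "odd q"
  shows "\<bar>real ((k * (k - 1) div 2) div q) + (\<Sum>i<k. real (i div q)) - (\<Sum>i<k. real (2 * i div q))
           - 1/2 * (real q * (nint_dist (real k / real q))\<^sup>2)\<bar> \<le> 2"
proof -
  obtain h where h: "q = 2 * h + 1" using assms by (elim oddE)
  hence q0: "q > 0" by simp
  define r where "r = k mod q"
  define m where "m = min (real r) (real q - real r)"
  define s where "s = (k + h) mod q"
  have r: "r < q" using q0 by (simp add: r_def)
  have "(\<Sum>i<k. real (2 * i div q)) - (\<Sum>i<k. real (i div q)) = (\<Sum>i<k. real ((i + h) div q))"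
    unfolding sum_subtractf[symmetric] h
    by (intro sum.cong refl) (metis double_div_minus_div of_int_diff of_int_of_nat_eq)
  \<comment> \<open>The added terms have \<open>i < h < q\<close> and vanish.\<close>
  also have "\<dots> = (\<Sum>i<k+h. real (i div q))"
    using sum_lessThan_add[of "\<lambda>i. real (i div q)" h k] by (simp add: h add.commute)
  also have "\<dots> = ((2 * real k - 1)\<^sup>2 - (2 * real s - real q)\<^sup>2) / (8 * real q)"
  proof -
    have "real_of_int (8 * int q * (\<Sum>i<k+h. int (i div q))) =
        real_of_int ((2 * int (k + h) - int q)\<^sup>2 - (2 * int s - int q)\<^sup>2)"
      unfolding s_def by (simp only: sum_div_below[OF q0])
    also have "2 * int (k + h) - int q = 2 * int k - 1" by (simp add: h)
    finally show ?thesis using q0 by (simp add: field_simps)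
  qed
  finally have S: "(\<Sum>i<k. real (2 * i div q)) - (\<Sum>i<k. real (i div q)) =
      ((2 * real k - 1)\<^sup>2 - (2 * real s - real q)\<^sup>2) / (8 * real q)" .
  have "s = (r + h) mod q" by (simp add: s_def r_def mod_add_left_eq)
  also have "\<dots> = (if r \<le> h then r + h else r + h - q)" using r by (auto simp: h mod_if)
  finally have s: "s = (if r \<le> h then r + h else r + h - q)" .
  have m: "0 \<le> m" "m \<le> real q / 2" using r by (auto simp: m_def min_def)
  \<comment> \<open>Up to sign, \<open>2 * s - q\<close> is \<open>2 * m\<close> off by one; the
    direction depends on which side of \<open>h\<close> the residue lies.\<close>
  have "(2 * real s - real q)\<^sup>2 = (2 * m - 1)\<^sup>2 \<or> (2 * real s - real q)\<^sup>2 = (2 * m + 1)\<^sup>2"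
  proof (cases "r \<le> h")
    case True
    hence "m = real r" "2 * real s - real q = 2 * real r - 1" using h by (auto simp: m_def s)
    thus ?thesis by simp
  next
    case False
    hence "m = real q - real r" "2 * real s - real q = - (2 * (real q - real r) + 1)"
      using h r by (auto simp: m_def s of_nat_diff)
    thus ?thesis by (simp only: power2_minus) simp
  qed
  hence "\<bar>(2 * real s - real q)\<^sup>2 - 1 - 4 * m\<^sup>2\<bar> = 4 * m"
    using m by (auto simp: power2_eq_square algebra_simps)
  \<comment> \<open>The bound 1/4 comes from \<open>4 * m <= 2 * q\<close>.\<close>
  hence "\<bar>((2 * real s - real q)\<^sup>2 - 1 - 4 * m\<^sup>2) / (8 * real q)\<bar> \<le> 1/4"
    using m q0 by (simp add: field_simps)
  moreover have "real (k * (k - 1) div 2) = ((2 * real k - 1)\<^sup>2 - 1) / 8"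
    by (cases k) (auto simp: real_of_nat_div field_simps power2_eq_square)
  hence "real (k * (k - 1) div 2) / real q = ((2 * real k - 1)\<^sup>2 - 1) / (8 * real q)"
    by (simp only: divide_divide_eq_left)
  moreover have "1/2 * (real q * (nint_dist (real k / real q))\<^sup>2) = 4 * m\<^sup>2 / (8 * real q)"
    unfolding nint_dist_of_nat_divide[OF q0] using q0
    by (simp add: m_def r_def power2_eq_square)
  ultimately show ?thesis
    using real_div_bounds[OF q0, of "k * (k - 1) div 2"] S
    unfolding diff_divide_distrib by linarith
qed

section \<open>Legendre sums for the three functions\<close>

lemma multiplicity_prod_fact:
  fixes p :: nat and f :: "nat \<Rightarrow> nat"
  assumes "prime p" "\<And>i. i < k \<Longrightarrow> f i < p ^ Suc L"
  shows "multiplicity p (\<Prod>i<k. fact (f i)) = (\<Sum>l=1..L. \<Sum>i<k. f i div p ^ l)"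
proof -
  have "multiplicity p (\<Prod>i<k. fact (f i)) = (\<Sum>i<k. multiplicity p (fact (f i)))"
    using assms(1) by (intro prime_elem_multiplicity_prod_distrib) auto
  also have "\<dots> = (\<Sum>i<k. \<Sum>l=1..L. f i div p ^ l)"
    using assms by (intro sum.cong multiplicity_fact) auto
  finally show ?thesis by (subst (asm) sum.swap)
qed

lemma vp_g_U:
  assumes "prime p" "k\<^sup>2 + 2 * k < p ^ Suc L"
  shows "real_of_int (vp p (g_U (of_nat k))) = (\<Sum>l=1..L.
     real (k\<^sup>2 div p ^ l) + (\<Sum>i<k. real (i div p ^ l)) - (\<Sum>i<k. real ((k + i) div p ^ l)))"
proof -
  have "Gamma (1 + B_U (of_nat k)) = fact (k\<^sup>2)"
    unfolding B_U_def using Gamma_fact[of "k\<^sup>2"] by simp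
  hence "g_U (of_nat k) = of_nat (fact (k\<^sup>2) * (\<Prod>i<k. fact i)) / of_nat (\<Prod>i<k. fact (k + i))"
    by (simp add: g_U_def G_U_of_nat prod_dividef)
  hence "vp p (g_U (of_nat k)) = int (multiplicity p (fact (k\<^sup>2) * (\<Prod>i<k. fact i))) -
      int (multiplicity p (\<Prod>i<k. fact (k + i)))"
    using assms(1) by (simp only:) (intro vp_divide_of_nat, auto intro!: prod_pos)
  also have "multiplicity p (fact (k\<^sup>2) * (\<Prod>i<k. fact i)) =
      multiplicity p (fact (k\<^sup>2)) + multiplicity p (\<Prod>i<k. fact i)"
    using assms(1) by (intro prime_elem_multiplicity_mult_distrib) auto
  also have "multiplicity p (fact (k\<^sup>2)) = (\<Sum>l=1..L. k\<^sup>2 div p ^ l)"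
    using assms by (intro multiplicity_fact) auto
  also have "multiplicity p (\<Prod>i<k. fact i) = (\<Sum>l=1..L. \<Sum>i<k. i div p ^ l)"
    using assms by (intro multiplicity_prod_fact) auto
  also have "multiplicity p (\<Prod>i<k. fact (k + i)) = (\<Sum>l=1..L. \<Sum>i<k. (k + i) div p ^ l)"
    using assms by (intro multiplicity_prod_fact) auto
  finally show ?thesis by (simp add: sum.distrib sum_subtractf)
qed

text \<open>A common shape for the orthogonal and symplectic cases: \<open>d\<close> and
  \<open>e\<close> absorb their different powers of 2, which are invisible to an odd prime.\<close>

lemma vp_orthogonal_quotient:
  assumes "prime p" "odd p" "k\<^sup>2 + 2 * k < p ^ Suc L"
  shows "real_of_int (vp p (fact (k * (k - 1) div 2) / 2 ^ d * (\<Prod>i<k. 2 ^ e i * fact i / fact (2 * i)))) =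
    (\<Sum>l=1..L. real ((k * (k - 1) div 2) div p ^ l) + (\<Sum>i<k. real (i div p ^ l)) -
      (\<Sum>i<k. real (2 * i div p ^ l)))"
proof -
  let ?B = "k * (k - 1) div 2"
  have two: "multiplicity p (2 ^ n) = 0" for n
  proof -
    have "\<not> p dvd 2" using assms primes_dvd_imp_eq[of p 2] by auto
    thus ?thesis using assms(1) by (intro not_dvd_imp_multiplicity_0) (auto dest: prime_dvd_power)
  qed
  have "?B \<le> k * k" by (meson div_le_dividend diff_le_self le_trans mult_le_mono2)
  hence B: "?B < p ^ Suc L" using assms(3) by (simp add: power2_eq_square)
  have "fact ?B / 2 ^ d * (\<Prod>i<k. 2 ^ e i * fact i / fact (2 * i)) =
      of_nat (fact ?B * (2 ^ (\<Sum>i<k. e i) * (\<Prod>i<k. fact i))) / (of_nat (2 ^ d * (\<Prod>i<k. fact (2 * i))) :: complex)"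
    by (simp add: prod_dividef prod.distrib power_sum)
  hence "vp p (fact ?B / 2 ^ d * (\<Prod>i<k. 2 ^ e i * fact i / fact (2 * i))) =
      int (multiplicity p (fact ?B * (2 ^ (\<Sum>i<k. e i) * (\<Prod>i<k. fact i)))) -
      int (multiplicity p (2 ^ d * (\<Prod>i<k. fact (2 * i))))"
    using assms(1) by (simp only:) (intro vp_divide_of_nat, auto intro!: prod_pos)
  also have "multiplicity p (fact ?B * (2 ^ (\<Sum>i<k. e i) * (\<Prod>i<k. fact i))) =
      multiplicity p (fact ?B) + multiplicity p (\<Prod>i<k. fact i)"
    using assms(1) by (simp add: prime_elem_multiplicity_mult_distrib two)
  also have "multiplicity p (2 ^ d * (\<Prod>i<k. fact (2 * i))) = multiplicity p (\<Prod>i<k. fact (2 * i))"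
    using assms(1) by (simp add: prime_elem_multiplicity_mult_distrib two)
  also have "multiplicity p (fact ?B) = (\<Sum>l=1..L. ?B div p ^ l)"
    using assms(1) B by (intro multiplicity_fact) auto
  also have "multiplicity p (\<Prod>i<k. fact i) = (\<Sum>l=1..L. \<Sum>i<k. i div p ^ l)"
    using assms by (intro multiplicity_prod_fact) auto
  also have "multiplicity p (\<Prod>i<k. fact (2 * i)) = (\<Sum>l=1..L. \<Sum>i<k. 2 * i div p ^ l)"
    using assms by (intro multiplicity_prod_fact) auto
  finally show ?thesis by (simp add: sum.distrib sum_subtractf)
qed

text \<open>Written to match \<open>vp_orthogonal_quotient\<close> with \<open>d = 1\<close> and
  \<open>e = Suc\<close>; \<open>2 ^ 1\<close> is the prefactor 1/2 of \<open>G_O\<close>.\<close>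

lemma g_O_of_nat:
  "g_O (of_nat k) = fact (k * (k - 1) div 2) / 2 ^ 1 * (\<Prod>i<k. 2 ^ Suc i * fact i / fact (2 * i))"
proof -
  have "2 * (k * (k - 1) div 2) = k * (k - 1)" by (cases k) auto
  hence "2 * of_nat (k * (k - 1) div 2) = (of_nat (k * (k - 1)) :: complex)"
    by (metis of_nat_mult of_nat_numeral)
  hence "B_O (of_nat k) = of_nat (k * (k - 1) div 2)"
    by (cases k) (simp_all add: B_O_def field_simps)
  thus ?thesis using Gamma_fact[of "k * (k - 1) div 2"] by (simp add: g_O_def G_O_of_nat)
qed

text \<open>\<open>B_Sp\<close> at \<open>k\<close> equals \<open>B_O\<close> at
  \<open>k + 1\<close>, and the factor for \<open>i = 0\<close> is 1. An index shift thus gives the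
  orthogonal shape at \<open>Suc k\<close>, with \<open>d = 0\<close>.\<close>

lemma g_Sp_of_nat:
  "g_Sp (of_nat k) = fact (Suc k * (Suc k - 1) div 2) / 2 ^ 0 *
     (\<Prod>i<Suc k. 2 ^ i * fact i / fact (2 * i))"
proof -
  have "2 * (Suc k * k div 2) = Suc k * k" by simp
  hence "2 * of_nat (Suc k * k div 2) = (of_nat (Suc k * k) :: complex)"
    by (metis of_nat_mult of_nat_numeral)
  hence "1 + B_Sp (of_nat k) = 1 + of_nat (Suc k * (Suc k - 1) div 2)"
    by (simp add: B_Sp_def field_simps)
  hence "Gamma (1 + B_Sp (of_nat k)) = fact (Suc k * (Suc k - 1) div 2)"
    by (simp only: Gamma_fact)
  moreover have "(\<Prod>i<Suc k. 2 ^ i * fact i / fact (2 * i)) =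
      (\<Prod>i<k. 2 ^ Suc i * fact (Suc i) / fact (2 * Suc i) :: complex)"
    by (subst prod.lessThan_Suc_shift) simp
  ultimately show ?thesis
    by (simp only: g_Sp_def G_Sp_of_nat power_0 div_by_1)
qed

lemma vp_g_U_approx:
  assumes "prime p" "k\<^sup>2 + 2 * k < p ^ Suc L"
  shows "\<bar>real_of_int (vp p (g_U (of_nat k))) -
     1 * (\<Sum>l=1..L. real p ^ l * (nint_dist (real k / real p ^ l))\<^sup>2)\<bar> \<le> 1 * real L"
proof -
  have "p > 0" using assms(1) prime_gt_0_nat by blast
  have "\<bar>real_of_int (vp p (g_U (of_nat k))) -
     (\<Sum>l=1..L. real p ^ l * (nint_dist (real k / real p ^ l))\<^sup>2)\<bar> \<le> (\<Sum>l=1..L. 1)"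
    unfolding vp_g_U[OF assms] sum_subtractf[symmetric]
    by (rule order_trans[OF sum_abs], rule sum_mono)
       (use unitary_term_bound[of "p ^ _" k] \<open>p > 0\<close> in simp)
  thus ?thesis by simp
qed

lemma vp_orthogonal_approx:
  assumes "prime p" "odd p" "k\<^sup>2 + 2 * k < p ^ Suc L"
  shows "\<bar>real_of_int (vp p (fact (k * (k - 1) div 2) / 2 ^ d * (\<Prod>i<k. 2 ^ e i * fact i / fact (2 * i)))) -
     1/2 * (\<Sum>l=1..L. real p ^ l * (nint_dist (real k / real p ^ l))\<^sup>2)\<bar> \<le> 2 * real L"
proof -
  have "\<bar>real_of_int (vp p (fact (k * (k - 1) div 2) / 2 ^ d * (\<Prod>i<k. 2 ^ e i * fact i / fact (2 * i)))) -
     1/2 * (\<Sum>l=1..L. real p ^ l * (nint_dist (real k / real p ^ l))\<^sup>2)\<bar> \<le> (\<Sum>l=1..L. 2)"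
    unfolding vp_orthogonal_quotient[OF assms] sum_subtractf[symmetric] sum_distrib_left
    by (rule order_trans[OF sum_abs], rule sum_mono)
       (use orthogonal_term_bound[of "p ^ _" k] \<open>odd p\<close> in simp)
  thus ?thesis by simp
qed

theorem theorem6p1:
  fixes p :: nat and x :: real
  assumes "prime p" and "odd p" and "x > 0"
  defines "k \<equiv> (\<lambda>j::nat. \<lfloor>real p ^ j * x\<rfloor>)"
  shows "(\<lambda>j. real_of_int (vp p (g_U (of_int (k j))))) \<sim>[sequentially]
           (\<lambda>j. real_of_int (k j) * c_p p x) \<and>
         (\<lambda>j. real_of_int (vp p (g_O (of_int (k j))))) \<sim>[sequentially]
           (\<lambda>j. 1/2 * real_of_int (k j) * c_p p x) \<and>
         (\<lambda>j. real_of_int (vp p (g_Sp (of_int (k j))))) \<sim>[sequentially]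
           (\<lambda>j. 1/2 * real_of_int (k j) * c_p p x)"
proof -
  have p: "p > 1" using assms(1) prime_gt_1_nat by blast
  define K where "K j = nat (k j)" for j
  have k0: "k j \<ge> 0" for j using assms(3) by (simp add: k_def)
  have kK: "(of_int (k j) :: complex) = of_nat (K j)" for j using k0[of j] by (simp add: K_def)
  have "real (K j) = of_int \<lfloor>real p ^ j * x\<rfloor>" for j using k0[of j] by (simp add: K_def k_def)
  \<comment> \<open>From \<open>k j <= p ^ j * x < k j + 1\<close>, both the floor and its successor
    are admissible in \<open>valuation_asymp_equiv\<close>.\<close>
  hence K: "\<bar>real (K j) - real p ^ j * x\<bar> \<le> 1" "\<bar>real (Suc (K j)) - real p ^ j * x\<bar> \<le> 1" for j
    by (simp_all add: abs_le_iff; linarith)+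
  \<comment> \<open>The comparison so far is with \<open>p ^ j * x\<close>; taking the floor is a
    vanishing relative error.\<close>
  have kx: "(\<lambda>j. real_of_int (k j)) \<sim>[sequentially] (\<lambda>j. real p ^ j * x)"
  proof (rule asymp_equivI')
    have "(\<lambda>j. inverse (real p) ^ j * (1 / x)) \<longlonglongrightarrow> 0 * (1 / x)"
      using p by (intro tendsto_mult LIMSEQ_power_zero tendsto_const) (simp add: inverse_less_1_iff)
    hence lim: "(\<lambda>j. inverse (real p) ^ j * (1 / x)) \<longlonglongrightarrow> 0" by (simp only: mult_zero_left)
    have bound: "eventually (\<lambda>j. norm (real_of_int (k j) / (real p ^ j * x) - 1) \<le>
        inverse (real p) ^ j * (1 / x)) sequentially"
    proof (intro always_eventually allI)
      fix j
      have P: "real p ^ j * x > 0" using p assms(3) by simp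
      have "real_of_int (k j) / (real p ^ j * x) - 1 = (real (K j) - real p ^ j * x) / (real p ^ j * x)"
        using P p k0[of j] by (auto simp: K_def diff_divide_distrib)
      hence "norm (real_of_int (k j) / (real p ^ j * x) - 1) = \<bar>real (K j) - real p ^ j * x\<bar> / (real p ^ j * x)"
        by (simp only: real_norm_def abs_divide abs_of_pos[OF P])
      also have "\<dots> \<le> 1 / (real p ^ j * x)" using P K(1)[of j] by (intro divide_right_mono) auto
      finally show "norm (real_of_int (k j) / (real p ^ j * x) - 1) \<le> inverse (real p) ^ j * (1 / x)"
        by (simp add: power_inverse divide_inverse)
    qed
    have "(\<lambda>j. real_of_int (k j) / (real p ^ j * x) - 1) \<longlonglongrightarrow> 0"
      by (rule Lim_null_comparison[OF bound lim])
    thus "(\<lambda>j. real_of_int (k j) / (real p ^ j * x)) \<longlonglongrightarrow> 1"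
      by (rule LIM_zero_cancel)
  qed
  have k: "(\<lambda>j. c * (real p ^ j * x) * c_p p x) \<sim>[sequentially] (\<lambda>j. c * real_of_int (k j) * c_p p x)" for c
    by (intro asymp_equiv_mult asymp_equiv_refl asymp_equiv_symI[OF kx])
  have "(\<lambda>j. real_of_int (vp p (g_U (of_nat (K j))))) \<sim>[sequentially] (\<lambda>j. 1 * (real p ^ j * x) * c_p p x)"
    by (rule valuation_asymp_equiv[OF p assms(3) _ K(1), where D = 1], simp)
       (intro always_eventually allI impI vp_g_U_approx[OF assms(1)], assumption)
  hence "(\<lambda>j. real_of_int (vp p (g_U (of_int (k j))))) \<sim>[sequentially] (\<lambda>j. 1 * real_of_int (k j) * c_p p x)"
    unfolding kK by (rule asymp_equiv_trans[OF _ k])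
  moreover have "(\<lambda>j. real_of_int (vp p (g_O (of_nat (K j))))) \<sim>[sequentially] (\<lambda>j. 1/2 * (real p ^ j * x) * c_p p x)"
    unfolding g_O_of_nat
    by (rule valuation_asymp_equiv[OF p assms(3) _ K(1), where D = 2], simp)
       (intro always_eventually allI impI vp_orthogonal_approx[OF assms(1,2)], assumption)
  hence "(\<lambda>j. real_of_int (vp p (g_O (of_int (k j))))) \<sim>[sequentially] (\<lambda>j. 1/2 * real_of_int (k j) * c_p p x)"
    unfolding kK by (rule asymp_equiv_trans[OF _ k])
  \<comment> \<open>The symplectic value at \<open>K j\<close> has the orthogonal shape at
    \<open>Suc (K j)\<close>, hence the second bound in \<open>K\<close>.\<close>
  moreover have "(\<lambda>j. real_of_int (vp p (g_Sp (of_nat (K j))))) \<sim>[sequentially] (\<lambda>j. 1/2 * (real p ^ j * x) * c_p p x)"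
    unfolding g_Sp_of_nat
    by (rule valuation_asymp_equiv[OF p assms(3) _ K(2), where D = 2], simp)
       (intro always_eventually allI impI vp_orthogonal_approx[OF assms(1,2)], assumption)
  hence "(\<lambda>j. real_of_int (vp p (g_Sp (of_int (k j))))) \<sim>[sequentially] (\<lambda>j. 1/2 * real_of_int (k j) * c_p p x)"
    unfolding kK by (rule asymp_equiv_trans[OF _ k])
  ultimately show ?thesis by (simp only: mult_1_left conj_assoc)
qed

end
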